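(* Let $\mathfrak{A}$ be a complex unital $C^*$-algebra, let $x\in\mathfrak{A}$ be a regular element with Moore-Penrose inverse $x^{\dagger}$, and let $\mu\ge 0$ be real. Then $$v^2(x)\le \frac{1}{2(1+\mu)}\,v(x)\,\big\|xx^{\dagger}+x^*x\big\|+\frac{\mu}{4(1+\mu)}\big\|xx^{\dagger}+x^*x\big\|^2\le \frac14\big\|x^*x+xx^{\dagger}\big\|^2 .$$
   Context: $\mathcal{S}(\mathfrak{A})$ denotes the set of states of $\mathfrak{A}$ (positive linear functionals $\varphi$ with $\varphi(\mathbf{1}_{\mathfrak{A}})=1$), and $v(x)=\sup\{|\varphi(x)|:\varphi\in\mathcal{S}(\mathfrak{A})\}$ is the algebraic numerical radius; $v^2(x)$ means $(v(x))^2$. An element $x\in\mathfrak{A}$ is regular if there is $x'\in\mathfrak{A}$ with $x=xx'x$. Every regular $x\in\mathfrak{A}$ has a unique Moore-Penrose inverse, i.e. a unique $x^{\dagger}\in\mathfrak{A}$ with $x^{\dagger}=x^{\dagger}xx^{\dagger}$, $x=xx^{\dagger}x$, $(x^{\dagger}x)^*=x^{\dagger}x$, $(xx^{\dagger})^*=xx^{\dagger}$. *)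

theory Defs
  imports "HOL-Analysis.Analysis"
begin

(* The real structure inherited from the superclasses supplies the ring, the unit, completeness,
   submultiplicativity of the norm and norm 1 = 1 (so the zero algebra is excluded). *)
class unital_cstar_algebra = real_normed_algebra_1 + banach +
  fixes scaleC :: "complex \<Rightarrow> 'a \<Rightarrow> 'a" (infixr "*\<^sub>C" 75)
    and star :: "'a \<Rightarrow> 'a"
  assumes scaleC_add_right: "c *\<^sub>C (x + y) = c *\<^sub>C x + c *\<^sub>C y"
    and scaleC_add_left: "(c + d) *\<^sub>C x = c *\<^sub>C x + d *\<^sub>C x"
    and scaleC_scaleC: "c *\<^sub>C d *\<^sub>C x = (c * d) *\<^sub>C x"
    and scaleC_of_real: "complex_of_real r *\<^sub>C x = r *\<^sub>R x"
    and scaleC_mult_left: "(c *\<^sub>C x) * y = c *\<^sub>C (x * y)"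
    and scaleC_mult_right: "x * (c *\<^sub>C y) = c *\<^sub>C (x * y)"
    and norm_scaleC: "norm (c *\<^sub>C x) = cmod c * norm x"
    and star_add: "star (x + y) = star x + star y"
    and star_scaleC: "star (c *\<^sub>C x) = cnj c *\<^sub>C star x"
    and star_mult: "star (x * y) = star y * star x"
    and star_star: "star (star x) = x"
    and cstar_identity: "norm (star x * x) = (norm x)\<^sup>2"

definition complex_linear_functional :: "('a::unital_cstar_algebra \<Rightarrow> complex) \<Rightarrow> bool" where
  "complex_linear_functional \<phi> \<longleftrightarrow>
     (\<forall>x y. \<phi> (x + y) = \<phi> x + \<phi> y) \<and> (\<forall>c x. \<phi> (c *\<^sub>C x) = c * \<phi> x)"

definition positive_functional :: "('a::unital_cstar_algebra \<Rightarrow> complex) \<Rightarrow> bool" where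
  "positive_functional \<phi> \<longleftrightarrow>
     complex_linear_functional \<phi> \<and> (\<forall>a. \<phi> (star a * a) \<in> \<real>\<^sub>\<ge>\<^sub>0)"

definition states :: "('a::unital_cstar_algebra \<Rightarrow> complex) set" where
  "states = {\<phi>. positive_functional \<phi> \<and> \<phi> 1 = 1}"

(* The supremum is formed in [0, infinity], where it always exists. It is finite because
   |phi x| \<le> norm x for every state phi. *)
definition numerical_radius :: "'a::unital_cstar_algebra \<Rightarrow> real" where
  "numerical_radius x = enn2real (SUP \<phi>\<in>states. ennreal (cmod (\<phi> x)))"

definition regular_element :: "'a::unital_cstar_algebra \<Rightarrow> bool" where
  "regular_element x \<longleftrightarrow> (\<exists>x'. x = x * x' * x)"

definition is_moore_penrose_inverse :: "'a::unital_cstar_algebra \<Rightarrow> 'a \<Rightarrow> bool" where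
  "is_moore_penrose_inverse x xd \<longleftrightarrow>
     xd = xd * x * xd \<and> x = x * xd * x \<and> star (xd * x) = xd * x \<and> star (x * xd) = x * xd"

end

theory Submission
  imports Defs
begin

text \<open>
  Every term of the chain is controlled by the single bound \<open>v(x) \<le> N / 2\<close> with
  \<open>N = \<parallel>p + x\<^sup>*x\<parallel>\<close> and \<open>p = xx\<^sup>\<dagger>\<close>. As \<open>p\<close> is a projection with \<open>x = px\<close>, positivity of a state
  \<open>\<phi>\<close> gives \<open>2 |\<phi>(x)| = 2 |\<phi>(p\<^sup>*x)| \<le> \<phi>(p\<^sup>*p) + \<phi>(x\<^sup>*x) = \<phi>(p + x\<^sup>*x)\<close>, and the last value is at
  most \<open>N\<close>, because \<open>1 - a/r\<close> has a self-adjoint square root (the binomial series) whenever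
  \<open>a\<close> is self-adjoint and \<open>r > \<parallel>a\<parallel>\<close>.
\<close>

lemma star_scaleR: "star (r *\<^sub>R x) = r *\<^sub>R star (x :: 'a::unital_cstar_algebra)"
  by (metis complex_cnj_complex_of_real scaleC_of_real star_scaleC)

lemma star_one: "star (1 :: 'a::unital_cstar_algebra) = 1"
  by (metis mult.right_neutral star_mult star_star mult_1_left)

text \<open>The C*-identity and submultiplicativity bound the norm of any element by that of its
  adjoint; applying this to \<open>star x\<close> as well gives equality.\<close>

lemma norm_star: "norm (star x) = norm (x :: 'a::unital_cstar_algebra)"
proof -
  have le: "norm y \<le> norm (star y)" for y :: 'a
  proof (cases "y = 0")
    case False
    have "norm y * norm y \<le> norm (star y) * norm y"
      by (metis cstar_identity norm_mult_ineq power2_eq_square)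
    then show ?thesis using False by simp
  qed simp
  show ?thesis using le[of x] le[of "star x"] by (simp add: star_star)
qed

lemma bounded_linear_star: "bounded_linear (star :: 'a::unital_cstar_algebra \<Rightarrow> 'a)"
  by (rule bounded_linear_intro[where K = 1]) (simp_all add: star_add star_scaleR norm_star)

lemma star_power: "star (x ^ n) = star (x :: 'a::unital_cstar_algebra) ^ n"
  by (induction n) (simp_all add: star_one star_mult power_commutes)

text \<open>The witness is the binomial series with exponent 1/2 at \<open>a\<close>. Its
  coefficients are real and \<open>star\<close> is continuous, so the sum is self-adjoint;
  Vandermonde's identity evaluates its square.\<close>

lemma self_adjoint_sqrt_one_plus:
  fixes a :: "'a::unital_cstar_algebra"
  assumes "star a = a" and "norm a < 1"
  obtains b where "star b = b" and "b * b = 1 + a"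
proof -
  define f where "f n = ((1/2::real) gchoose n) *\<^sub>R a ^ n" for n
  \<comment> \<open>Convergence at a point \<open>t\<close> strictly beyond \<open>norm a\<close>
    yields the absolute convergence at \<open>norm a\<close> that the Cauchy product
    requires.\<close>
  obtain t where t: "norm a < t" "t < 1" using assms(2) dense by blast
  have "0 < t" using t(1) norm_ge_zero[of a] by linarith
  then have "summable (\<lambda>n. ((1/2::real) gchoose n) * t ^ n)"
    using gen_binomial_real[of t "1/2"] t(2) sums_summable by force
  then have "summable (\<lambda>n. norm (((1/2::real) gchoose n) * norm a ^ n))"
    by (rule powser_insidea) (use t(1) in simp)
  then have sn: "summable (\<lambda>n. norm (f n))"
    by (rule summable_comparison_test')
      (simp add: f_def abs_mult mult_left_mono norm_power_ineq)
  have sf: "summable f" by (rule summable_norm_cancel[OF sn])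
  have "star (suminf f) = (\<Sum>n. star (f n))"
    by (rule bounded_linear.suminf[OF bounded_linear_star sf])
  moreover have "(\<lambda>n. star (f n)) = f"
    by (simp add: fun_eq_iff f_def star_scaleR star_power assms(1))
  ultimately have 1: "star (suminf f) = suminf f" by simp
  have conv: "(\<Sum>i\<le>k. f i * f (k - i)) = ((1::real) gchoose k) *\<^sub>R a ^ k" for k
  proof -
    have "(\<Sum>i\<le>k. f i * f (k - i))
        = (\<Sum>i\<le>k. (((1/2::real) gchoose i) * ((1/2) gchoose (k - i))) *\<^sub>R a ^ k)"
      by (rule sum.cong) (simp_all add: f_def mult.commute flip: power_add)
    also have "\<dots> = ((1::real) gchoose k) *\<^sub>R a ^ k"
      using gbinomial_Vandermonde[of "1/2::real" "1/2" k] by (simp add: atLeast0AtMost flip: scaleR_sum_left)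
    finally show ?thesis .
  qed
  \<comment> \<open>The coefficients of the square are those of exponent 1, which vanish for
    \<open>k > 1\<close>, leaving \<open>1 + a\<close>.\<close>
  have "(1::real) gchoose k = of_nat (1 choose k)" for k
    using binomial_gbinomial[of 1 k, where 'a = real] by simp
  then have "(\<Sum>k. ((1::real) gchoose k) *\<^sub>R a ^ k) = (\<Sum>k\<in>{..1}. ((1::real) gchoose k) *\<^sub>R a ^ k)"
    by (intro suminf_finite) (auto simp: binomial_eq_0)
  then have "suminf f * suminf f = 1 + a"
    unfolding Cauchy_product[OF sn sn] conv by simp
  with 1 show thesis by (rule that)
qed

context
  fixes \<phi> :: "'a::unital_cstar_algebra \<Rightarrow> complex"
  assumes pos: "positive_functional \<phi>"
begin

lemma functional_add: "\<phi> (x + y) = \<phi> x + \<phi> y"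
  and functional_scaleC: "\<phi> (c *\<^sub>C x) = c * \<phi> x"
  and functional_nonneg: "\<phi> (star x * x) \<in> \<real>\<^sub>\<ge>\<^sub>0"
  using pos by (auto simp: positive_functional_def complex_linear_functional_def)

lemma functional_scaleR: "\<phi> (r *\<^sub>R x) = complex_of_real r * \<phi> x"
  by (metis functional_scaleC scaleC_of_real)

lemma functional_sesquilinear_expand:
  "\<phi> (star (y + c *\<^sub>C z) * (y + c *\<^sub>C z))
    = \<phi> (star y * y) + c * \<phi> (star y * z) + cnj c * \<phi> (star z * y) + cnj c * c * \<phi> (star z * z)"
  by (simp add: star_add star_scaleC distrib_left distrib_right scaleC_mult_left scaleC_mult_right
      functional_add functional_scaleC)

text \<open>Polarisation: the value at \<open>y + c z\<close> is real, so \<open>c = 1\<close>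
  matches the imaginary parts and \<open>c = \<i>\<close> the real parts.\<close>

lemma functional_hermitian: "\<phi> (star z * y) = cnj (\<phi> (star y * z))"
proof -
  have "Im (\<phi> (star (y + c *\<^sub>C z) * (y + c *\<^sub>C z))) = 0" "Im (\<phi> (star w * w)) = 0" for c w
    using functional_nonneg by (simp_all add: complex_nonneg_Reals_iff)
  from this(1)[of 1] this(1)[of \<i>] this(2)[of y] this(2)[of z] show ?thesis
    unfolding functional_sesquilinear_expand by (simp add: complex_eq_iff)
qed

text \<open>Positivity at \<open>y + c z\<close>, where the unimodular \<open>c\<close> rotates the
  cross term onto the negative real axis.\<close>

lemma functional_arith_mean_bound:
  "2 * cmod (\<phi> (star y * z)) \<le> Re (\<phi> (star y * y)) + Re (\<phi> (star z * z))"
proof -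
  define u where "u = \<phi> (star y * z)"
  obtain c where c: "cmod c = 1" "c * u = - complex_of_real (cmod u)"
  proof (cases "u = 0")
    case False
    then show thesis
      by (intro that[of "- cnj u / cmod u"])
        (simp_all add: norm_divide complex_norm_square[symmetric] power2_eq_square mult.commute)
  qed (use that[of 1] in simp)
  have "cnj c * c = 1"
    using c(1) by (metis complex_norm_square mult.commute of_real_1 power_one)
  moreover have "cnj c * cnj u = - complex_of_real (cmod u)"
    using c(2) by (metis complex_cnj_complex_of_real complex_cnj_minus complex_cnj_mult)
  ultimately have "\<phi> (star (y + c *\<^sub>C z) * (y + c *\<^sub>C z))
      = \<phi> (star y * y) + \<phi> (star z * z) - 2 * complex_of_real (cmod u)"
    using c(2) unfolding functional_sesquilinear_expand functional_hermitian[of z y] u_def by simp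
  then show ?thesis
    using functional_nonneg[of "y + c *\<^sub>C z"] by (simp add: complex_nonneg_Reals_iff u_def)
qed

lemma functional_le_norm:
  assumes "star a = a"
  shows "Re (\<phi> a) \<le> norm a * Re (\<phi> 1)"
\<comment> \<open>The square root needs norm strictly below 1, so \<open>a\<close> is rescaled to
  norm \<open>s < 1\<close>; the claim follows since \<open>s\<close> is arbitrary.\<close>
proof (rule field_le_mult_one_interval)
  fix s :: real
  assume s: "0 < s" "s < 1"
  show "s * Re (\<phi> a) \<le> norm a * Re (\<phi> 1)"
  proof (cases "a = 0")
    case True
    then show ?thesis using functional_add[of 0 0] by simp
  next
    case False
    let ?a = "(- (s / norm a)) *\<^sub>R a"
    obtain b where b: "star b = b" "b * b = 1 + ?a"
      using s False assms by (elim self_adjoint_sqrt_one_plus[rotated 2])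
        (simp_all add: star_scaleR del: scaleR_minus_left)
    have "0 \<le> Re (\<phi> (star b * b))"
      using functional_nonneg[of b] by (simp add: complex_nonneg_Reals_iff)
    then have "s / norm a * Re (\<phi> a) \<le> Re (\<phi> 1)"
      by (simp add: b functional_add functional_scaleR del: scaleR_minus_left)
    then show ?thesis using False by (simp add: field_simps)
  qed
qed

end

lemma numerical_radius_le:
  assumes "0 \<le> B" and "\<And>\<phi>. \<phi> \<in> states \<Longrightarrow> cmod (\<phi> x) \<le> B"
  shows "numerical_radius x \<le> B"
  unfolding numerical_radius_def
  by (rule enn2real_leI) (use assms in \<open>auto intro!: SUP_least ennreal_leI\<close>)

text \<open>Here \<open>p = star p * p\<close> and \<open>x = star p * x\<close>, so the arithmetic
  mean bound applies to the pair \<open>p\<close>, \<open>x\<close>. The projection will be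
  \<open>x * xd\<close>.\<close>

lemma numerical_radius_le_half_norm:
  fixes x :: "'a::unital_cstar_algebra"
  assumes "star p = p" and "p * p = p" and "p * x = x"
  shows "numerical_radius x \<le> norm (p + star x * x) / 2"
proof (rule numerical_radius_le)
  fix \<phi> :: "'a \<Rightarrow> complex"
  assume "\<phi> \<in> states"
  then have pos: "positive_functional \<phi>" and one: "\<phi> 1 = 1" by (simp_all add: states_def)
  have "2 * cmod (\<phi> x) \<le> Re (\<phi> (p + star x * x))"
    using functional_arith_mean_bound[OF pos, of p x] by (simp add: assms functional_add[OF pos])
  also have "\<dots> \<le> norm (p + star x * x)"
    using functional_le_norm[OF pos, of "p + star x * x"]
    by (simp add: assms one star_add star_mult star_star)
  finally show "cmod (\<phi> x) \<le> norm (p + star x * x) / 2" by simp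
qed simp

theorem theorem4p1:
  fixes x xd :: "'a::unital_cstar_algebra" and \<mu> :: real
  assumes "regular_element x"
    and "is_moore_penrose_inverse x xd"
    and "\<mu> \<ge> 0"
  shows "(numerical_radius x)\<^sup>2
           \<le> 1 / (2 * (1 + \<mu>)) * numerical_radius x * norm (x * xd + star x * x)
             + \<mu> / (4 * (1 + \<mu>)) * (norm (x * xd + star x * x))\<^sup>2
       \<and> 1 / (2 * (1 + \<mu>)) * numerical_radius x * norm (x * xd + star x * x)
             + \<mu> / (4 * (1 + \<mu>)) * (norm (x * xd + star x * x))\<^sup>2
           \<le> 1 / 4 * (norm (star x * x + x * xd))\<^sup>2"
proof -
  define v where "v = numerical_radius x"
  \<comment> \<open>In terms of \<open>h\<close> the middle expression is the mean of
    \<open>v * h\<close> and \<open>h\<^sup>2\<close> with weights \<open>1 / (1 + \<mu>)\<close>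
    and \<open>\<mu> / (1 + \<mu>)\<close>.\<close>
  define h where "h = norm (x * xd + star x * x) / 2"
  have mp: "xd = xd * x * xd" "x = x * xd * x" "star (x * xd) = x * xd"
    using assms(2) by (simp_all add: is_moore_penrose_inverse_def)
  have "v \<le> h"
    unfolding v_def h_def
    by (rule numerical_radius_le_half_norm) (use mp in \<open>simp_all add: mult.assoc\<close>)
  have "0 \<le> v" by (simp add: v_def numerical_radius_def)
  have vv: "v\<^sup>2 \<le> v * h" and vh: "v * h \<le> h\<^sup>2"
    using \<open>v \<le> h\<close> \<open>0 \<le> v\<close> by (simp_all add: power2_eq_square mult_mono)
  have mid: "1 / (2 * (1 + \<mu>)) * v * (2 * h) + \<mu> / (4 * (1 + \<mu>)) * (2 * h)\<^sup>2
      = (v * h + \<mu> * h\<^sup>2) / (1 + \<mu>)"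
  proof -
    \<comment> \<open>At \<open>m = 0\<close> both sides are 0 by the convention for
      division.\<close>
    have "1 / (2 * m) * v * (2 * h) + \<mu> / (4 * m) * (2 * h)\<^sup>2 = (v * h + \<mu> * h\<^sup>2) / m"
      for m
      by (simp add: add_divide_distrib power2_eq_square)
    then show ?thesis .
  qed
  \<comment> \<open>Added to \<open>vv\<close>, this is the first inequality multiplied by
    \<open>1 + \<mu>\<close>; the second comes from \<open>vh\<close> alone.\<close>
  have "\<mu> * v\<^sup>2 \<le> \<mu> * h\<^sup>2" using vv vh assms(3) by (intro mult_left_mono) auto
  then have "v\<^sup>2 \<le> (v * h + \<mu> * h\<^sup>2) / (1 + \<mu>)" and "(v * h + \<mu> * h\<^sup>2) / (1 + \<mu>) \<le> h\<^sup>2"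
    using assms(3) vv vh by (simp_all add: field_simps)
  moreover have "norm (x * xd + star x * x) = 2 * h" "norm (star x * x + x * xd) = 2 * h"
    by (simp_all add: h_def add.commute)
  moreover have "1 / 4 * (2 * h)\<^sup>2 = h\<^sup>2" by (simp add: power2_eq_square)
  ultimately show ?thesis
    unfolding v_def[symmetric] using mid by metis
qed

end
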